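(* Let $$f(s)=2+e^{-3s}(s+1)\left(1-\frac{s^2}{2}-\frac{s^3}{3}-\frac{s^4}{8}\right)+e^{-2s}\left(2s+\frac{5s^2}{2}+\frac{s^3}{2}\right)-e^{-s}\left(3+2s\right),$$ and let $\beta\approx 1.26575$ be the positive root of $f(s)-1=0$. Then $\tau_{\mathtt{HAM}}\ge\beta$, where $\tau_{\mathtt{HAM}}$ is the threshold constant of the semi-random graph process for the property of containing a Hamiltonian cycle.
   Context: **Semi-random graph process.** Let $[n]=\{1,\dots,n\}$ and let $G_0$ be the empty graph on $[n]$. In each step $t\ge 1$ a vertex $u_t$ is chosen uniformly at random from $[n]$, independently of the past; the player, who knows the history and $u_t$, selects a vertex $v_t\in[n]$, and the edge $u_tv_t$ is added. $G_t$ is the (multi)graph obtained after $t$ steps. A strategy $\mathcal S$ specifies, for every $n\ge1$ and every $t\ge1$, a probability distribution $f_t(u_1,v_1,\dots,u_{t-1},v_{t-1},u_t)$ on $[n]$, from which $v_t$ is drawn. For a monotone increasing property $\mathcal P$ and $0<q<1$, let $\tau_{\mathcal P}(\mathcal S,q,n)$ be the minimum $t\ge0$ such that $\mathbb P[G_t\in\mathcal P]\ge q$ when $\mathcal S$ is followed ($\infty$ if there is none), let $\tau_{\mathcal P}(q,n)=\inf_{\mathcal S}\tau_{\mathcal P}(\mathcal S,q,n)$, and let $$\tau_{\mathcal P}=\lim_{q\to1^-}\limsup_{n\to\infty}\frac{\tau_{\mathcal P}(q,n)}{n}.$$ $\mathtt{HAM}$ is the property of containing a Hamiltonian cycle. 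*)

theory Defs
  imports "HOL-Probability.Probability"
begin

section \<open>The semi-random graph process\<close>

text \<open>
  A history is the list of pairs (u_1, v_1), ..., (u_t, v_t) in chronological order.  A strategy
  takes n, the history of the first t - 1 steps and the vertex u_t, and returns the distribution
  of v_t; the step number t is one more than the length of the history.
\<close>

type_synonym history = "(nat \<times> nat) list"
type_synonym strategy = "nat \<Rightarrow> history \<Rightarrow> nat \<Rightarrow> nat pmf"

definition valid_strategy :: "strategy \<Rightarrow> bool" where
  "valid_strategy S \<longleftrightarrow>
     (\<forall>n\<ge>1. \<forall>h u. set h \<subseteq> {1..n} \<times> {1..n} \<longrightarrow> u \<in> {1..n} \<longrightarrow> set_pmf (S n h u) \<subseteq> {1..n})"

primrec history_pmf :: "strategy \<Rightarrow> nat \<Rightarrow> nat \<Rightarrow> history pmf" where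
  "history_pmf S n 0 = return_pmf []"
| "history_pmf S n (Suc t) =
     bind_pmf (history_pmf S n t) (\<lambda>h.
     bind_pmf (pmf_of_set {1..n}) (\<lambda>u.
     bind_pmf (S n h u) (\<lambda>v. return_pmf (h @ [(u, v)]))))"

text \<open>
  A multigraph on the vertex set {1..n} is given by n and the multiset of its edges, an edge being
  the set of its endpoints; loops are the singletons.
\<close>

type_synonym multigraph = "nat set multiset"

definition graph_of :: "history \<Rightarrow> multigraph" where
  "graph_of h = mset (map (\<lambda>(u, v). {u, v}) h)"

definition graph_pmf :: "strategy \<Rightarrow> nat \<Rightarrow> nat \<Rightarrow> multigraph pmf" where
  "graph_pmf S n t = map_pmf graph_of (history_pmf S n t)"


section \<open>The threshold constant of a graph property\<close>

text \<open>The argument n of a property is the number of vertices.\<close>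

type_synonym graph_property = "nat \<Rightarrow> multigraph \<Rightarrow> bool"

definition monotone_increasing :: "graph_property \<Rightarrow> bool" where
  "monotone_increasing P \<longleftrightarrow> (\<forall>n G H. P n G \<longrightarrow> G \<subseteq># H \<longrightarrow> P n H)"

text \<open>The infimum of a nonempty set of type enat is its minimum, and that of the empty set is
  \<open>\<infinity>\<close>.\<close>

definition tau_strategy :: "graph_property \<Rightarrow> strategy \<Rightarrow> real \<Rightarrow> nat \<Rightarrow> enat" where
  "tau_strategy P S q n =
     Inf {enat t | t. q \<le> measure_pmf.prob (graph_pmf S n t) {G. P n G}}"

definition tau_n :: "graph_property \<Rightarrow> real \<Rightarrow> nat \<Rightarrow> enat" where
  "tau_n P q n = (INF S \<in> {S. valid_strategy S}. tau_strategy P S q n)"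

definition tau_q :: "graph_property \<Rightarrow> real \<Rightarrow> ereal" where
  "tau_q P q = limsup (\<lambda>n. ereal_of_enat (tau_n P q n) / ereal (real n))"

definition tau :: "graph_property \<Rightarrow> ereal" where
  "tau P = Lim (at_left 1) (tau_q P)"

lemma tau_q_mono:
  assumes "p \<le> q"
  shows "tau_q P p \<le> tau_q P q"
proof -
  have "tau_strategy P S p n \<le> tau_strategy P S q n" for S n
    unfolding tau_strategy_def by (rule Inf_superset_mono) (use assms in force)
  then have *: "tau_n P p n \<le> tau_n P q n" for n
    unfolding tau_n_def by (intro INF_mono) auto
  have "\<forall>\<^sub>F n in sequentially. ereal_of_enat (tau_n P p n) / ereal (real n)
          \<le> ereal_of_enat (tau_n P q n) / ereal (real n)"
    using eventually_gt_at_top[of 0]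
    by eventually_elim (use * in \<open>auto intro!: ereal_divide_right_mono\<close>)
  then show ?thesis
    unfolding tau_q_def by (rule Limsup_mono)
qed

text \<open>The limit in the definition of \<open>tau\<close> always exists.\<close>

lemma tau_q_tendsto_tau: "(tau_q P \<longlongrightarrow> tau P) (at_left 1)"
proof -
  have "(tau_q P \<longlongrightarrow> (SUP q \<in> {..<1}. tau_q P q)) (at_left 1)"
  proof (rule increasing_tendsto)
    show "\<forall>\<^sub>F q in at_left 1. tau_q P q \<le> (SUP q \<in> {..<1}. tau_q P q)"
      by (auto simp: eventually_at_filter intro!: always_eventually SUP_upper)
  next
    fix x assume "x < (SUP q \<in> {..<1}. tau_q P q)"
    then obtain p where p: "p < 1" "x < tau_q P p"
      by (auto simp: less_SUP_iff)
    have "\<forall>\<^sub>F q in at_left 1. q \<in> {p<..<1}"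
      using p(1) by (auto simp: eventually_at_left_field)
    then show "\<forall>\<^sub>F q in at_left 1. x < tau_q P q"
      by eventually_elim (use p(2) in \<open>auto intro: less_le_trans[OF _ tau_q_mono[OF less_imp_le]]\<close>)
  qed
  then show ?thesis
    unfolding tau_def by (subst tendsto_Lim) (auto simp: trivial_limit_at_left_real)
qed


section \<open>Hamiltonian cycles\<close>

text \<open>
  The edges of the cycle are counted with multiplicity, so for n = 2 two parallel edges are
  required, and for n = 1 a loop.
\<close>

definition HAM :: graph_property where
  "HAM n G \<longleftrightarrow>
     (\<exists>c. distinct c \<and> set c = {1..n} \<and>
          mset (map (\<lambda>i. {c ! i, c ! (Suc i mod n)}) [0..<n]) \<subseteq># G)"

lemma HAM_monotone_increasing: "monotone_increasing HAM"
  unfolding monotone_increasing_def HAM_def by (blast intro: subset_mset.order_trans)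


section \<open>The constant\<close>

definition ham_f :: "real \<Rightarrow> real" where
  "ham_f s = 2 + exp (- 3 * s) * (s + 1) * (1 - s^2 / 2 - s^3 / 3 - s^4 / 8)
           + exp (- 2 * s) * (2 * s + 5 * s^2 / 2 + s^3 / 2)
           - exp (- s) * (3 + 2 * s)"

definition beta :: real where
  "beta = (THE s. 0 < s \<and> ham_f s - 1 = 0)"

end

theory Submission
  imports Defs "HOL-Real_Asymp.Real_Asymp"
begin

text \<open>
  The bound comes out of a fractional cover of the edges of a Hamiltonian cycle.  Run the process
  for \<open>T = s n\<close> steps and call a vertex light if it was the random endpoint at most once, or
  twice with the first time before step \<open>K = \<theta> n\<close>.  A Hamiltonian cycle has at most two
  edges at every vertex, so \<open>n\<close> is at most twice the number of heavy vertices plus the number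
  of steps that join two distinct light vertices.  Lightness is inherited by subsets of the set of
  hits, so the player cannot make the vertex \<open>v_i\<close> lighter than a vertex that is hit only after
  step \<open>i\<close>: whatever the strategy, the expectation of the right hand side is at most
  \<open>n\<close> times an explicit function of \<open>s\<close> and \<open>\<theta>\<close>, up to \<open>o(n)\<close>.  For
  \<open>s = 1.27\<close> and \<open>\<theta> = 0.37\<close> this function is below 1, so the probability of a
  Hamiltonian cycle stays away from 1.  Thus the threshold is at least 1.27, which exceeds
  \<open>beta\<close>.
\<close>

section \<open>The root of the equation defining beta\<close>

text \<open>The Lagrange remainder of the Taylor polynomial has the sign of its power of
  \<open>- x\<close>. Stopping after an even number of terms therefore bounds from below, after an
  odd number from above.\<close>

lemma exp_neg_bounds:
  fixes x :: real
  assumes "0 < x"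
  shows "(\<Sum>k<2 * N. (- x) ^ k / fact k) \<le> exp (- x)"
    and "exp (- x) \<le> (\<Sum>k<Suc (2 * N). (- x) ^ k / fact k)"
proof -
  obtain t where "exp (- x) = (\<Sum>k<2 * N. (- x) ^ k / fact k) + exp t / fact (2 * N) * (- x) ^ (2 * N)"
    using Maclaurin_exp_le[of "- x" "2 * N"] by blast
  then show "(\<Sum>k<2 * N. (- x) ^ k / fact k) \<le> exp (- x)"
    by (simp add: power_mult)
  obtain t where "exp (- x) = (\<Sum>k<Suc (2 * N). (- x) ^ k / fact k)
      + exp t / fact (Suc (2 * N)) * (- x) ^ Suc (2 * N)"
    using Maclaurin_exp_le[of "- x" "Suc (2 * N)"] by blast
  moreover have "exp t / fact (Suc (2 * N)) * (- x) ^ Suc (2 * N) \<le> 0"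
    using assms by (simp add: power_mult mult_nonneg_nonpos)
  ultimately show "exp (- x) \<le> (\<Sum>k<Suc (2 * N). (- x) ^ k / fact k)"
    by linarith
qed

lemma exp_127_bounds: "0.280831 \<le> exp (- 1.27 :: real)" "exp (- 1.27 :: real) \<le> 0.280832"
  using exp_neg_bounds(1)[of "1.27" 6] exp_neg_bounds(2)[of "1.27" 6]
  by (simp_all add: lessThan_nat_numeral fact_numeral power_divide)

text \<open>The final estimate takes \<open>s = 1.27\<close> and
  \<open>m = 1.27 - 0.37 = 0.9\<close>, and involves only \<open>exp (- s)\<close> and
  \<open>exp (- m)\<close>.\<close>

lemma exp_09_bounds: "0.406569 \<le> exp (- 0.9 :: real)" "exp (- 0.9 :: real) \<le> 0.40657"
  using exp_neg_bounds(1)[of "0.9" 5] exp_neg_bounds(2)[of "0.9" 5]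
  by (simp_all add: lessThan_nat_numeral fact_numeral power_divide)

definition ham_f_deriv :: "real \<Rightarrow> real" where
  "ham_f_deriv s = exp (- s) * (1 + 2 * s) + exp (- 2 * s) * (2 + s - 7 * s^2 / 2 - s^3)
     + exp (- 3 * s) * (- 2 - 4 * s - s^2 + 2 * s^3 / 3 + 3 * s^4 / 4 + 3 * s^5 / 8)"

lemma ham_f_has_deriv: "(ham_f has_real_derivative ham_f_deriv s) (at s)"
  unfolding ham_f_def[abs_def] ham_f_deriv_def
  by (rule derivative_eq_intros refl | simp)+ (simp add: field_simps eval_nat_numeral)

text \<open>Multiplication by \<open>exp (3 * s)\<close> gives
  \<open>exp s * ((1 + 2 * s) * exp s + ?p) + ?q\<close>. The inner \<open>exp s\<close> is bounded
  below by its cubic Taylor polynomial; the bracket is then positive by \<open>r\<close>, so the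
  outer \<open>exp s\<close> may be replaced by \<open>1 + s\<close>. A polynomial positive for
  \<open>s > 0\<close> remains.\<close>

lemma ham_f_deriv_pos:
  assumes "0 < s"
  shows "0 < ham_f_deriv s"
proof -
  let ?p = "2 + s - 7 * s^2 / 2 - s^3" and ?q = "- 2 - 4 * s - s^2 + 2 * s^3 / 3 + 3 * s^4 / 4 + 3 * s^5 / 8"
  have e3: "1 + s + s^2 / 2 + s^3 / 6 \<le> exp s"
  proof -
    obtain t where "exp s = (\<Sum>k<4. s ^ k / fact k) + exp t / fact 4 * s ^ 4"
      using Maclaurin_exp_le[of s 4] by blast
    then show ?thesis
      using assms by (simp add: eval_nat_numeral)
  qed
  have e1: "1 + s \<le> exp s" by simp
  have r: "0 < 3 + 4 * s - s^2 + s^3 / 6 + s^4 / 3"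
  proof -
    \<comment> \<open>This square lets the constant and the \<open>s^4\<close> term absorb
      \<open>- s^2\<close>.\<close>
    have "0 \<le> (s^2 / 2 - 1)^2" by simp
    also have "\<dots> = s^4 / 4 - s^2 + 1" by (simp add: power2_eq_square eval_nat_numeral algebra_simps)
    finally show ?thesis
      using assms zero_less_power[OF assms, of 3] zero_less_power[OF assms, of 4] by linarith
  qed
  have "0 < (1 + s) * (3 + 4 * s - s^2 + s^3 / 6 + s^4 / 3) + ?q"
  proof -
    \<comment> \<open>Completing the square absorbs the only negative coefficient,
      \<open>- 1 / 6\<close> at \<open>s^3\<close>.\<close>
    have "(1 + s) * (3 + 4 * s - s^2 + s^3 / 6 + s^4 / 3) + ?q
        = 1 + 3 * s + s^2 * ((s / 2 - 1 / 6)^2 + 71 / 36) + s^4 + s^5 * (17 / 24)"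
      by (simp add: power2_eq_square eval_nat_numeral field_simps)
    also have "\<dots> > 0" using assms by (simp add: add_pos_nonneg)
    finally show ?thesis .
  qed
  also have "\<dots> \<le> exp s * (3 + 4 * s - s^2 + s^3 / 6 + s^4 / 3) + ?q"
    using e1 r by (intro add_right_mono mult_right_mono) auto
  also have "3 + 4 * s - s^2 + s^3 / 6 + s^4 / 3 = (1 + 2 * s) * (1 + s + s^2 / 2 + s^3 / 6) + ?p"
    by (simp add: power2_eq_square eval_nat_numeral field_simps)
  also have "exp s * ((1 + 2 * s) * (1 + s + s^2 / 2 + s^3 / 6) + ?p) + ?q
      \<le> exp s * ((1 + 2 * s) * exp s + ?p) + ?q"
    using e3 assms by (intro add_right_mono mult_left_mono) auto
  also have "\<dots> = exp (3 * s) * ham_f_deriv s"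
  proof -
    have e: "exp (3 * s) * exp (- s) = exp s * exp s" "exp (3 * s) * exp (- 2 * s) = exp s"
      "exp (3 * s) * exp (- 3 * s) = 1"
      by (simp_all flip: exp_add)
    show ?thesis
      unfolding ham_f_deriv_def distrib_left mult.assoc[symmetric] e by (simp add: algebra_simps)
  qed
  finally show ?thesis
    by (simp add: zero_less_mult_iff)
qed

lemma ham_f_strict_mono:
  assumes "0 \<le> a" "a < b"
  shows "ham_f a < ham_f b"
proof (rule DERIV_pos_imp_increasing_open[OF assms(2)])
  show "\<exists>y. DERIV ham_f x :> y \<and> 0 < y" if "a < x" "x < b" for x
    using that assms ham_f_has_deriv ham_f_deriv_pos by (meson le_less_trans)
  show "continuous_on {a..b} ham_f"
    using ham_f_has_deriv by (meson DERIV_continuous_on has_field_derivative_at_within)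
qed

text \<open>As a cubic in \<open>exp (- s)\<close>, \<open>ham_f s\<close> can be evaluated from a
  single enclosure of \<open>exp (- s)\<close>.\<close>

lemma ham_f_alt: "ham_f s = 2 + (s + 1) * (1 - s\<^sup>2 / 2 - s ^ 3 / 3 - s ^ 4 / 8) * exp (- s) ^ 3
   + (2 * s + 5 * s\<^sup>2 / 2 + s ^ 3 / 2) * exp (- s) ^ 2 - (3 + 2 * s) * exp (- s)"
proof -
  have "exp (- 2 * s) = exp (- s) ^ 2" "exp (- 3 * s) = exp (- s) ^ 3"
    by (simp_all flip: exp_of_nat_mult)
  then show ?thesis
    unfolding ham_f_def by (simp add: mult_ac)
qed

section \<open>Numerical location of the root\<close>

lemma exp_126575_bounds: "0.2820276 \<le> exp (- 1.26575 :: real)" "exp (- 1.26575 :: real) \<le> 0.2820278"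
  using exp_neg_bounds(1)[of "1.26575" 6] exp_neg_bounds(2)[of "1.26575" 6]
  by (simp_all add: lessThan_nat_numeral fact_numeral power_divide)

text \<open>\<open>ham_f\<close> passes through 1 between 1.26575 and 1.26576, so its values at both
  points differ from 1 by less than \<open>1 / 10 ^ 5\<close>, and the enclosures of the exponential
  have to be finer than that.\<close>

lemma exp_126576_bounds: "0.282024875 \<le> exp (- 1.26576 :: real)" "exp (- 1.26576 :: real) \<le> 0.282024877"
  using exp_neg_bounds(1)[of "1.26576" 7] exp_neg_bounds(2)[of "1.26576" 7]
  by (simp_all add: lessThan_nat_numeral fact_numeral power_divide)

lemma ham_f_126575: "ham_f 1.26575 < 1"
proof -
  define E :: real where "E = exp (- 1.26575)"
  note E = exp_126575_bounds[folded E_def]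
  \<comment> \<open>At this point the factor of \<open>E ^ 3\<close> in \<open>ham_f_alt\<close> is
    negative and that of \<open>E ^ 2\<close> positive, so an upper bound for \<open>ham_f\<close>
    takes these two directions. For the lower bound at 1.26576 they are reversed.\<close>
  have "0.2820276 ^ 3 \<le> E ^ 3" "E ^ 2 \<le> 0.2820278 ^ 2"
    using E by (intro power_mono; simp)+
  then show ?thesis
    unfolding ham_f_alt[of "1.26575"] E_def[symmetric] using E by (simp add: power_divide)
qed

lemma ham_f_126576: "1 < ham_f 1.26576"
proof -
  define E :: real where "E = exp (- 1.26576)"
  note E = exp_126576_bounds[folded E_def]
  have "E ^ 3 \<le> 0.282024877 ^ 3" "0.282024875 ^ 2 \<le> E ^ 2"
    using E by (intro power_mono; simp)+
  then show ?thesis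
    unfolding ham_f_alt[of "1.26576"] E_def[symmetric] using E by (simp add: power_divide)
qed

lemma ham_root_ex1: "\<exists>!s. 0 < s \<and> ham_f s - 1 = 0"
  and beta_close: "\<bar>beta - 1.26575\<bar> < 1 / 10 ^ 5"
proof -
  have "\<exists>s\<ge>1.26575. s \<le> 1.26576 \<and> ham_f s = 1"
    using ham_f_126575 ham_f_126576 ham_f_has_deriv DERIV_isCont
    by (intro IVT) (auto simp: less_imp_le)
  then obtain s where s: "1.26575 \<le> s" "s \<le> 1.26576" "ham_f s = 1"
    by blast
  have uniq: "s' = s" if "0 < s' \<and> ham_f s' - 1 = 0" for s'
    using that s ham_f_strict_mono[of s s'] ham_f_strict_mono[of s' s] by (cases s s' rule: linorder_cases) auto
  show ex1: "\<exists>!s. 0 < s \<and> ham_f s - 1 = 0"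
    using s uniq by (intro ex1I[of _ s]) auto
  have "beta = s"
    unfolding beta_def using s uniq by (intro the_equality) auto
  \<comment> \<open>The intermediate value theorem gives a closed interval; its right end has to be
    excluded for the strict inequality.\<close>
  moreover have "s \<noteq> 1.26576"
    using s(3) ham_f_126576 by (metis less_irrefl)
  ultimately show "\<bar>beta - 1.26575\<bar> < 1 / 10 ^ 5"
    using s by (simp add: abs_less_iff)
qed

section \<open>Probabilities of events of the process\<close>

lemma length_history:
  assumes "h \<in> set_pmf (history_pmf S n t)"
  shows "length h = t"
  using assms by (induction t arbitrary: h) auto

lemma emeasure_history_Suc:
  "emeasure (history_pmf S n (Suc t)) X
    = (\<integral>\<^sup>+h. \<integral>\<^sup>+u. \<integral>\<^sup>+v. indicator X (h @ [(u, v)]) \<partial>S n h u \<partial>pmf_of_set {1..n} \<partial>history_pmf S n t)"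
  by simp

text \<open>Given \<open>h\<close>, the vertex \<open>u\<close> is uniform, and \<open>R\<close> is
  relaxed to a condition that does not mention \<open>v\<close>. The choice of the player thus
  integrates to 1 and each step costs at most the factor \<open>c\<close>.\<close>

lemma prob_history_Suc_le:
  assumes "1 \<le> n" "0 \<le> c"
    and R: "\<And>h u v. h \<in> set_pmf (history_pmf S n t) \<Longrightarrow> R (h @ [(u, v)]) \<Longrightarrow> P h \<and> u \<in> Q h"
    and Q: "\<And>h. h \<in> set_pmf (history_pmf S n t) \<Longrightarrow> P h \<Longrightarrow> real (card ({1..n} \<inter> Q h)) \<le> c * real n"
  shows "measure_pmf.prob (history_pmf S n (Suc t)) {h. R h}
    \<le> c * measure_pmf.prob (history_pmf S n t) {h. P h}"
proof -
  have "(\<integral>\<^sup>+u. \<integral>\<^sup>+v. indicator {h. R h} (h @ [(u, v)]) \<partial>S n h u \<partial>pmf_of_set {1..n})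
      \<le> ennreal c * indicator {h. P h} h" (is "?l \<le> _")
    if h: "h \<in> set_pmf (history_pmf S n t)" for h
  proof (cases "P h")
    case True
    have "?l \<le> (\<integral>\<^sup>+u. indicator (Q h) u \<partial>pmf_of_set {1..n})"
    proof (rule nn_integral_mono)
      fix u
      have "(\<integral>\<^sup>+v. indicator {h. R h} (h @ [(u, v)]) \<partial>S n h u) \<le> (\<integral>\<^sup>+v. indicator (Q h) u \<partial>S n h u)"
        using R[OF h] by (intro nn_integral_mono) (auto simp: indicator_def)
      then show "(\<integral>\<^sup>+v. indicator {h. R h} (h @ [(u, v)]) \<partial>S n h u) \<le> indicator (Q h) u"
        by simp
    qed
    also have "\<dots> = ennreal (real (card ({1..n} \<inter> Q h)) / real n)"
      using assms(1) by (simp add: emeasure_pmf_of_set)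
    also have "\<dots> \<le> ennreal c"
      using Q[OF h True] assms(1) by (intro ennreal_leI) (simp add: divide_le_eq)
    finally show ?thesis using True by simp
  next
    case False
    then have "indicator {h. R h} (h @ [(u, v)]) = (0 :: ennreal)" for u v
      using R[OF h] by (auto simp: indicator_def)
    then show ?thesis by simp
  qed
  then have "emeasure (history_pmf S n (Suc t)) {h. R h}
      \<le> (\<integral>\<^sup>+h. ennreal c * indicator {h. P h} h \<partial>history_pmf S n t)"
    unfolding emeasure_history_Suc by (intro nn_integral_mono_AE AE_pmfI)
  also have "\<dots> = ennreal (c * measure_pmf.prob (history_pmf S n t) {h. P h})"
    using assms(2) by (simp add: nn_integral_cmult measure_pmf.emeasure_eq_measure ennreal_mult)
  finally show ?thesis
    using assms(2) by (simp add: measure_pmf.emeasure_eq_measure)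
qed

lemma prob_history_Suc_eq:
  assumes "1 \<le> n"
    and R: "\<And>h u v. h \<in> set_pmf (history_pmf S n t) \<Longrightarrow> R (h @ [(u, v)]) \<longleftrightarrow> P h \<and> u \<in> B"
  shows "measure_pmf.prob (history_pmf S n (Suc t)) {h. R h}
    = real (card ({1..n} \<inter> B)) / real n * measure_pmf.prob (history_pmf S n t) {h. P h}"
proof -
  have "(\<integral>\<^sup>+u. \<integral>\<^sup>+v. indicator {h. R h} (h @ [(u, v)]) \<partial>S n h u \<partial>pmf_of_set {1..n})
      = ennreal (real (card ({1..n} \<inter> B)) / real n) * indicator {h. P h} h"
    if h: "h \<in> set_pmf (history_pmf S n t)" for h
  proof -
    have "indicator {h. R h} (h @ [(u, v)]) = (indicator B u * indicator {h. P h} h :: ennreal)" for u v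
      using R[OF h] by (auto simp: indicator_def)
    then show ?thesis
      using assms(1) by (simp add: nn_integral_multc emeasure_pmf_of_set)
  qed
  then have "emeasure (history_pmf S n (Suc t)) {h. R h}
      = (\<integral>\<^sup>+h. ennreal (real (card ({1..n} \<inter> B)) / real n) * indicator {h. P h} h \<partial>history_pmf S n t)"
    unfolding emeasure_history_Suc by (intro nn_integral_cong_AE AE_pmfI)
  also have "\<dots> = ennreal (real (card ({1..n} \<inter> B)) / real n * measure_pmf.prob (history_pmf S n t) {h. P h})"
    by (subst ennreal_mult) (simp_all add: nn_integral_cmult measure_pmf.emeasure_eq_measure)
  finally show ?thesis
    by (simp add: measure_pmf.emeasure_eq_measure)
qed

text \<open>Independence of the random endpoints, which holds whatever the strategy does.\<close>

lemma prob_history_prod: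
  assumes "1 \<le> n"
  shows "measure_pmf.prob (history_pmf S n t) {h. \<forall>j<t. fst (h ! j) \<in> B j}
    = (\<Prod>j<t. real (card ({1..n} \<inter> B j)) / real n)"
proof (induction t)
  case (Suc t)
  have "measure_pmf.prob (history_pmf S n (Suc t)) {h. \<forall>j<Suc t. fst (h ! j) \<in> B j}
    = real (card ({1..n} \<inter> B t)) / real n
      * measure_pmf.prob (history_pmf S n t) {h. \<forall>j<t. fst (h ! j) \<in> B j}"
    by (rule prob_history_Suc_eq[OF assms])
      (auto simp: nth_append length_history less_Suc_eq)
  then show ?case using Suc by (simp add: mult.commute)
qed simp

lemma prob_history_mono:
  assumes "s \<le> t" "\<And>h x. R h \<Longrightarrow> R (h @ [x])"
  shows "measure_pmf.prob (history_pmf S n s) {h. R h} \<le> measure_pmf.prob (history_pmf S n t) {h. R h}"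
  using assms(1)
proof (induction t rule: dec_induct)
  case (step t)
  have "emeasure (history_pmf S n t) {h. R h} = (\<integral>\<^sup>+h. indicator {h. R h} h \<partial>history_pmf S n t)"
    by simp
  \<comment> \<open>Dummy integrals over the next pair, each of total mass 1, make the two sides
    comparable pointwise.\<close>
  also have "\<dots> = (\<integral>\<^sup>+h. \<integral>\<^sup>+u. \<integral>\<^sup>+v. indicator {h. R h} h \<partial>S n h u \<partial>pmf_of_set {1..n} \<partial>history_pmf S n t)"
    by simp
  also have "\<dots> \<le> emeasure (history_pmf S n (Suc t)) {h. R h}"
    unfolding emeasure_history_Suc
    by (intro nn_integral_mono) (use assms(2) in \<open>auto simp: indicator_def\<close>)
  finally have "measure_pmf.prob (history_pmf S n t) {h. R h} \<le> measure_pmf.prob (history_pmf S n (Suc t)) {h. R h}"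
    by (simp add: measure_pmf.emeasure_eq_measure)
  with step show ?case by simp
qed simp

section \<open>Covering a Hamiltonian cycle\<close>

text \<open>At most two of the \<open>n\<close> cycle edges meet a given vertex outside
  \<open>L\<close>. Every other cycle edge joins two distinct vertices of \<open>L\<close>, and
  since the cycle is contained with multiplicity, these edges are at most as many as the steps that
  join such vertices.\<close>

lemma HAM_size_bound:
  assumes "HAM n (graph_of h)" "2 \<le> n"
  shows "n \<le> 2 * card {v \<in> {1..n}. \<not> L v}
    + card {i. i < length h \<and> fst (h ! i) \<noteq> snd (h ! i) \<and> L (fst (h ! i)) \<and> L (snd (h ! i))
                \<and> fst (h ! i) \<in> {1..n} \<and> snd (h ! i) \<in> {1..n}}"
proof -
  obtain c where c: "distinct c" "set c = {1..n}"
    and sub: "mset (map (\<lambda>i. {c ! i, c ! (Suc i mod n)}) [0..<n]) \<subseteq># graph_of h"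
    using assms(1) unfolding HAM_def by blast
  define e where "e i = {c ! i, c ! (Suc i mod n)}" for i
  define A where "A = {v \<in> {1..n}. \<not> L v}"
  have len: "length c = n"
    using c distinct_card by fastforce
  have inj: "inj_on ((!) c) {..<n}"
    using c(1) len by (auto simp: inj_on_def nth_eq_iff_index_eq)
  have inj_mod: "inj_on (\<lambda>i. Suc i mod n) {..<n}"
    by (auto simp: inj_on_def mod_Suc split: if_splits)
  have lt: "Suc i mod n < n" for i
    using assms(2) by simp
  define I where "I = {i. i < n \<and> e i \<inter> A \<noteq> {}}"
  define J where "J = {i. i < n \<and> e i \<inter> A = {}}"
  have "card {i. i < n \<and> c ! i \<in> A} \<le> card A"
    by (rule card_inj_on_le[of "(!) c"]) (auto intro: inj_on_subset[OF inj] simp: A_def)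
  moreover have "card {i. i < n \<and> c ! (Suc i mod n) \<in> A} \<le> card A"
  proof (rule card_inj_on_le[of "\<lambda>i. c ! (Suc i mod n)"])
    show "inj_on (\<lambda>i. c ! (Suc i mod n)) {i. i < n \<and> c ! (Suc i mod n) \<in> A}"
      by (rule inj_on_subset[OF comp_inj_on[OF inj_mod inj_on_subset[OF inj], unfolded o_def]])
        (use lt in auto)
  qed (auto simp: A_def)
  moreover have "card I \<le> card {i. i < n \<and> c ! i \<in> A} + card {i. i < n \<and> c ! (Suc i mod n) \<in> A}"
    by (rule order.trans[OF card_mono card_Un_le]) (auto simp: I_def e_def)
  ultimately have cI: "card I \<le> 2 * card A" by linarith
  \<comment> \<open>\<open>P\<close> depends on the edge as a set only, so it can filter the
    multiset of the cycle and that of the graph alike; \<open>card x = 2\<close> excludes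
    loops.\<close>
  define P where "P x \<longleftrightarrow> card x = 2 \<and> x \<subseteq> {1..n} \<and> x \<inter> A = {}" for x
  have P_e: "P (e i)" if "i \<in> J" for i
  proof -
    have "i < n" "e i \<inter> A = {}" using that by (auto simp: J_def)
    moreover have "Suc i mod n \<noteq> i"
      using assms(2) \<open>i < n\<close> by (auto simp: mod_Suc)
    then have "c ! i \<noteq> c ! (Suc i mod n)"
      using inj \<open>i < n\<close> lt[of i] by (auto simp: inj_on_def)
    moreover have "c ! i \<in> {1..n}" "c ! (Suc i mod n) \<in> {1..n}"
      using c(2) len \<open>i < n\<close> lt nth_mem by metis+
    ultimately show ?thesis
      by (auto simp: P_def e_def)
  qed
  have "card J \<le> card {i. i < n \<and> P (e i)}"
    by (rule card_mono) (use P_e in \<open>auto simp: J_def\<close>)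
  also have "\<dots> = length (filter P (map e [0..<n]))"
    unfolding length_filter_conv_card by (rule arg_cong[of _ _ card]) auto
  also have "\<dots> = size (filter_mset P (mset (map e [0..<n])))"
    unfolding mset_filter[symmetric] size_mset ..
  also have "\<dots> \<le> size (filter_mset P (graph_of h))"
    using sub unfolding e_def[abs_def] by (intro size_mset_mono multiset_filter_mono)
  also have "\<dots> = card {i. i < length h \<and> P ((\<lambda>(u, v). {u, v}) (h ! i))}"
    unfolding graph_of_def mset_filter[symmetric] size_mset length_filter_conv_card
    by (rule arg_cong[of _ _ card]) auto
  also have "\<dots> \<le> card {i. i < length h \<and> fst (h ! i) \<noteq> snd (h ! i) \<and> L (fst (h ! i)) \<and> L (snd (h ! i))
                \<and> fst (h ! i) \<in> {1..n} \<and> snd (h ! i) \<in> {1..n}}"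
    by (rule card_mono) (auto simp: P_def A_def card_2_iff split_beta doubleton_eq_iff)
  finally have cJ: "card J \<le> \<dots>" .
  have "n = card (I \<union> J)"
    by (subst card_lessThan[of n, symmetric], rule arg_cong[of _ _ card]) (auto simp: I_def J_def)
  also have "\<dots> \<le> card I + card J" by (rule card_Un_le)
  finally show ?thesis using cI cJ unfolding A_def by linarith
qed

section \<open>Light sets of hit times and their generating polynomials\<close>

text \<open>Steps are counted from 0.\<close>

definition hits :: "history \<Rightarrow> nat \<Rightarrow> nat set" where
  "hits h v = {j. j < length h \<and> fst (h ! j) = v}"

text \<open>\<open>finite U\<close> keeps out infinite sets, whose \<open>card\<close> is 0. For two
  hits, some \<open>j < K\<close> in \<open>U\<close> means that the first hit is before
  \<open>K\<close>.\<close>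

definition light :: "nat \<Rightarrow> nat set \<Rightarrow> bool" where
  "light K U \<longleftrightarrow> finite U \<and> card U \<le> 2 \<and> (card U = 2 \<longrightarrow> (\<exists>j\<in>U. j < K))"

text \<open>A two-element subset of a light set is the whole set, and smaller sets are always light.
  This makes the bound uniform over strategies: if a chosen vertex is light, so is the set of its
  hits after the step of the choice.\<close>

lemma light_subset:
  assumes "light K U" "V \<subseteq> U"
  shows "light K V"
proof (cases "card V = 2")
  case True
  then have "V = U"
    using assms card_seteq[of U V] by (auto simp: light_def)
  then show ?thesis using assms(1) by simp
next
  case False
  then show ?thesis
    using assms card_mono[of U V] by (auto simp: light_def finite_subset)
qed

lemma finite_light: "finite {V. V \<subseteq> {a..<b} \<and> light K V}" for a b :: nat
  by (rule finite_subset[of _ "Pow {a..<b}"]) auto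

lemma light_sets_eq:
  assumes "K \<le> T"
  shows "{V. V \<subseteq> {a..<T} \<and> light K V}
    = insert {} ((\<lambda>j. {j}) ` {a..<T} \<union> (\<lambda>(j, k). {j, k}) ` Sigma {a..<K} (\<lambda>j. {j<..<T}))"
    (is "?L = ?R")
proof
  show "?L \<subseteq> ?R"
  proof
    fix V assume "V \<in> ?L"
    then have V: "V \<subseteq> {a..<T}" "light K V" by auto
    then consider "card V = 0" | "card V = 1" | "card V = 2"
      by (auto simp: light_def le_Suc_eq numeral_2_eq_2)
    then show "V \<in> ?R"
    proof cases
      case 1
      then show ?thesis using V by (auto simp: light_def)
    next
      case 2
      then obtain j where "V = {j}" by (auto simp: card_1_singleton_iff)
      then show ?thesis using V by auto
    next
      case 3
      then obtain x y where "V = {x, y}" "x \<noteq> y"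
        by (auto simp: card_2_iff)
      then obtain j k where "V = {j, k}" "j < k"
        using that[of x y] that[of y x] by (cases x y rule: linorder_cases) (auto simp: insert_commute)
      moreover have "\<exists>j\<in>V. j < K" using V 3 by (auto simp: light_def)
      ultimately have "(j, k) \<in> Sigma {a..<K} (\<lambda>j. {j<..<T})" using V by auto
      then show ?thesis using \<open>V = {j, k}\<close> by (auto intro!: image_eqI[of _ _ "(j, k)"])
    qed
  qed
  show "?R \<subseteq> ?L"
    using assms by (auto simp: light_def card_insert_if)
qed

text \<open>A light pair is determined by its first time \<open>j < K\<close> and one of the
  \<open>T - Suc j\<close> later times.\<close>

lemma sum_light:
  fixes y :: real
  assumes "K \<le> T"
  shows "(\<Sum>V | V \<subseteq> {a..<T} \<and> light K V. y ^ card V)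
    = 1 + real (T - a) * y + (\<Sum>j=a..<K. real (T - Suc j)) * y ^ 2"
proof -
  let ?P = "Sigma {a..<K} (\<lambda>j. {j<..<T})"
  have card2: "card {j, k} = 2" if "(j, k) \<in> ?P" for j k
    using that by auto
  have inj: "inj_on (\<lambda>(j, k). {j, k}) ?P"
  proof (rule inj_onI)
    fix p q assume "p \<in> ?P" "q \<in> ?P" "(case p of (j, k) \<Rightarrow> {j, k}) = (case q of (j, k) \<Rightarrow> {j, k})"
    moreover obtain j k j' k' where "p = (j, k)" "q = (j', k')" by fastforce
    ultimately have "j < k" "j' < k'" "{j, k} = {j', k'}" by simp_all
    then have "j = j' \<and> k = k'" by (metis doubleton_eq_iff less_asym)
    then show "p = q" using \<open>p = (j, k)\<close> \<open>q = (j', k')\<close> by simp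
  qed
  have disj: "(\<lambda>j. {j}) ` {a..<T} \<inter> (\<lambda>(j, k). {j, k}) ` ?P = {}"
  proof -
    have "card V = 1" if "V \<in> (\<lambda>j. {j}) ` {a..<T}" for V :: "nat set"
      using that by force
    moreover have "card V = 2" if "V \<in> (\<lambda>(j, k). {j, k}) ` ?P" for V :: "nat set"
    proof -
      from that obtain p where "p \<in> ?P" "V = (case p of (j, k) \<Rightarrow> {j, k})" by blast
      then show ?thesis using card2[of "fst p" "snd p"] by (simp add: split_beta)
    qed
    ultimately show ?thesis
      by fastforce
  qed
  have nempty: "{} \<notin> (\<lambda>j. {j}) ` {a..<T}" "{} \<notin> (\<lambda>(j, k). {j, k}) ` ?P"
    by auto
  have "(\<Sum>V | V \<subseteq> {a..<T} \<and> light K V. y ^ card V)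
    = 1 + ((\<Sum>V\<in>(\<lambda>j. {j}) ` {a..<T}. y ^ card V) + (\<Sum>V\<in>(\<lambda>(j, k). {j, k}) ` ?P. y ^ card V))"
    unfolding light_sets_eq[OF assms]
    using disj nempty by (simp add: sum.union_disjoint)
  also have "(\<Sum>V\<in>(\<lambda>j. {j}) ` {a..<T}. y ^ card V) = real (T - a) * y"
    by (subst sum.reindex) auto
  also have "(\<Sum>V\<in>(\<lambda>(j, k). {j, k}) ` ?P. y ^ card V) = (\<Sum>p\<in>?P. y ^ 2)"
    unfolding sum.reindex[OF inj] by (intro sum.cong) (auto simp: card2 power2_eq_square)
  also have "\<dots> = real (card ?P) * y ^ 2"
    by (rule sum_constant)
  also have "card ?P = (\<Sum>j=a..<K. T - Suc j)"
    by (subst card_SigmaI) auto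
  finally show ?thesis by (simp only: of_nat_sum add.assoc)
qed

text \<open>The hit at \<open>i\<close> itself carries no weight, hence the exponent
  \<open>card U - 1\<close>. If \<open>i < K\<close>, any other step may be the second hit, and
  their number \<open>T - 1\<close> is rounded up to \<open>T\<close>; otherwise the other hit must
  lie before \<open>K\<close>.\<close>

lemma sum_light_through:
  fixes y :: real
  assumes "i < T" "K \<le> T" "0 \<le> y"
  shows "(\<Sum>U | U \<subseteq> {0..<T} \<and> light K U \<and> i \<in> U. y ^ (card U - 1))
    \<le> 1 + real (if i < K then T else K) * y"
proof -
  define J where "J = (if i < K then {..<T} else {..<K})"
  have "{U. U \<subseteq> {0..<T} \<and> light K U \<and> i \<in> U} \<subseteq> insert {i} ((\<lambda>j. {i, j}) ` (J - {i}))"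
  proof
    fix U assume "U \<in> {U. U \<subseteq> {0..<T} \<and> light K U \<and> i \<in> U}"
    then have U: "U \<subseteq> {0..<T}" "light K U" "i \<in> U" by auto
    then have "card U \<noteq> 0" by (auto simp: light_def)
    then consider "card U = 1" | "card U = 2"
      using U by (auto simp: light_def le_Suc_eq numeral_2_eq_2)
    then show "U \<in> insert {i} ((\<lambda>j. {i, j}) ` (J - {i}))"
    proof cases
      case 1
      then show ?thesis using U by (auto simp: card_1_singleton_iff)
    next
      case 2
      then obtain j where "U = {i, j}" "i \<noteq> j"
        using U(3) by (auto simp: card_2_iff)
      moreover have "\<exists>j\<in>U. j < K" using U 2 by (auto simp: light_def)
      ultimately show ?thesis using U by (auto simp: J_def)
    qed
  qed
  then have "(\<Sum>U | U \<subseteq> {0..<T} \<and> light K U \<and> i \<in> U. y ^ (card U - 1))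
      \<le> (\<Sum>U\<in>insert {i} ((\<lambda>j. {i, j}) ` (J - {i})). y ^ (card U - 1))"
    by (rule sum_mono2[rotated]) (use assms in \<open>auto simp: J_def\<close>)
  also have "\<dots> = 1 + (\<Sum>U\<in>(\<lambda>j. {i, j}) ` (J - {i}). y ^ (card U - 1))"
    by (subst sum.insert) (auto simp: J_def doubleton_eq_iff)
  also have "(\<Sum>U\<in>(\<lambda>j. {i, j}) ` (J - {i}). y ^ (card U - 1)) = (\<Sum>j\<in>J - {i}. y)"
    by (subst sum.reindex) (auto simp: inj_on_def doubleton_eq_iff intro!: sum.cong)
  also have "\<dots> \<le> real (card J) * y"
    using assms(3) by (simp add: mult_right_mono card_mono J_def)
  finally show ?thesis by (simp add: J_def split: if_splits)
qed

section \<open>Hits of a vertex and of an edge\<close>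

lemma card_inter_vertex:
  fixes u n :: nat
  assumes "u \<in> {1..n}"
  shows "card ({1..n} \<inter> (if b then {u} else - {u})) = (if b then 1 else n - 1)"
proof -
  have "{1..n} \<inter> - {u} = {1..n} - {u}" by auto
  then show ?thesis using assms by simp
qed

lemma prod_if_mem_power:
  assumes "finite A"
  shows "(\<Prod>j\<in>A. if j \<in> U then y else 1) = (y :: real) ^ card (A \<inter> U)"
  using prod.inter_restrict[OF assms, of "\<lambda>_. y" U] by simp

lemma prob_hits_eq:
  assumes "v \<in> {1..n}" "U \<subseteq> {..<t}"
  shows "measure_pmf.prob (history_pmf S n t) {h. hits h v = U}
    = (1 / real n) ^ card U * (1 - 1 / real n) ^ (t - card U)"
proof -
  have n: "1 \<le> n" using assms by auto
  have "measure_pmf.prob (history_pmf S n t) {h. hits h v = U}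
    = measure_pmf.prob (history_pmf S n t) {h. \<forall>j<t. fst (h ! j) \<in> (if j \<in> U then {v} else - {v})}"
    by (intro measure_pmf.finite_measure_eq_AE AE_pmfI)
      (use assms(2) in \<open>auto simp: hits_def length_history split: if_splits\<close>)
  also have "\<dots> = (\<Prod>j<t. if j \<in> U then 1 / real n else 1 - 1 / real n)"
    unfolding prob_history_prod[OF n] card_inter_vertex[OF assms(1)]
    using n by (intro prod.cong) (auto simp: field_simps of_nat_diff)
  also have "\<dots> = (1 / real n) ^ card U * (1 - 1 / real n) ^ card ({..<t} - U)"
    using assms(2) by (simp add: prod.If_cases Int_absorb1 Diff_eq flip: Compl_eq)
  also have "card ({..<t} - U) = t - card U"
    using assms(2) by (simp add: card_Diff_subset finite_subset)
  finally show ?thesis .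
qed

text \<open>After step \<open>i\<close> each new random endpoint has to avoid two vertices, before step \<open>i\<close>
  only one. A prescribed hit replaces a factor \<open>1 - 2 / n\<close> by \<open>1 / n\<close>.\<close>

lemma prob_hits_edge_le:
  assumes n: "3 \<le> n" and i: "i < T" "i \<in> U" and U: "U \<subseteq> {0..<T}" and V: "V \<subseteq> {Suc i..<T}"
  defines "y \<equiv> 1 / (real n - 2)"
  shows "measure_pmf.prob (history_pmf S n T)
      {h. fst (h ! i) \<noteq> snd (h ! i) \<and> fst (h ! i) \<in> {1..n} \<and> snd (h ! i) \<in> {1..n}
        \<and> hits h (fst (h ! i)) = U \<and> hits h (snd (h ! i)) \<inter> {Suc i..<T} = V}
    \<le> (1 - 1 / real n) ^ i * (1 - 2 / real n) ^ (T - Suc i) * y ^ (card U - 1) * y ^ card V"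
proof -
  \<comment> \<open>The part of the event decided by the first \<open>t\<close> steps. Before step
    \<open>i\<close> only the hits of the random endpoint are prescribed, because the player may
    choose the other endpoint in view of the past.\<close>
  define D where "D t h \<longleftrightarrow> fst (h ! i) \<noteq> snd (h ! i) \<and> fst (h ! i) \<in> {1..n} \<and> snd (h ! i) \<in> {1..n}
    \<and> (\<forall>j<i. (fst (h ! j) = fst (h ! i)) = (j \<in> U))
    \<and> (\<forall>j\<in>{Suc i..<t}. (fst (h ! j) = fst (h ! i)) = (j \<in> U) \<and> (fst (h ! j) = snd (h ! i)) = (j \<in> V))"
    for t and h :: history
  \<comment> \<open>\<open>c j\<close> bounds the conditional probability of the prescribed pattern
    at step \<open>j\<close>. As \<open>(1 - 2 / n) * y = 1 / n\<close>, one hit costs exactly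
    \<open>1 / n\<close>; two hits at once are impossible because the endpoints differ.\<close>
  define c where "c j = (1 - 2 / real n) * ((if j \<in> U then y else 1) * (if j \<in> V then y else 1))" for j
  have y: "0 < y" "(1 - 2 / real n) * y * real n = 1"
    using n by (auto simp: y_def field_simps)
  have c_nonneg: "0 \<le> c j" for j
    using y n by (auto simp: c_def)
  have base: "measure_pmf.prob (history_pmf S n (Suc i)) {h. D (Suc i) h}
      \<le> (\<Prod>j<i. (1 - 1 / real n) * (if j \<in> U then y else 1))"
  proof -
    \<comment> \<open>The vertex drawn at step \<open>i\<close> is split into its \<open>n\<close>
      values \<open>u\<close>. Since \<open>i \<in> U\<close>, step \<open>i\<close> contributes the
      factor \<open>1 / n\<close>, which the sum over \<open>u\<close> cancels.\<close>
    define B where "B u j = (if j \<in> U then {u} else - {u})" for u j :: nat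
    have "measure_pmf.prob (history_pmf S n (Suc i)) {h. D (Suc i) h}
      \<le> measure_pmf.prob (history_pmf S n (Suc i)) (\<Union>u\<in>{1..n}. {h. \<forall>j<Suc i. fst (h ! j) \<in> B u j})"
      by (rule measure_pmf.finite_measure_mono)
        (use i in \<open>auto simp: D_def B_def less_Suc_eq\<close>)
    also have "\<dots> \<le> (\<Sum>u\<in>{1..n}. measure_pmf.prob (history_pmf S n (Suc i)) {h. \<forall>j<Suc i. fst (h ! j) \<in> B u j})"
      by (rule measure_pmf.finite_measure_subadditive_finite) auto
    also have "\<dots> = (\<Sum>u\<in>{1..n}. (\<Prod>j<i. if j \<in> U then 1 / real n else 1 - 1 / real n) / real n)"
    proof (rule sum.cong)
      fix u assume u: "u \<in> {1..n}"
      have "measure_pmf.prob (history_pmf S n (Suc i)) {h. \<forall>j<Suc i. fst (h ! j) \<in> B u j}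
        = (\<Prod>j<Suc i. if j \<in> U then 1 / real n else 1 - 1 / real n)"
        using n unfolding B_def
        by (subst prob_history_prod, simp, subst card_inter_vertex[OF u], intro prod.cong)
          (auto simp: field_simps of_nat_diff)
      then show "measure_pmf.prob (history_pmf S n (Suc i)) {h. \<forall>j<Suc i. fst (h ! j) \<in> B u j}
        = (\<Prod>j<i. if j \<in> U then 1 / real n else 1 - 1 / real n) / real n"
        using i by simp
    qed simp
    also have "\<dots> = (\<Prod>j<i. if j \<in> U then 1 / real n else 1 - 1 / real n)"
      using n by simp
    also have "\<dots> \<le> (\<Prod>j<i. (1 - 1 / real n) * (if j \<in> U then y else 1))"
      using n by (intro prod_mono) (auto simp: y_def field_simps)
    finally show ?thesis .
  qed
  have "measure_pmf.prob (history_pmf S n t) {h. D t h}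
      \<le> (\<Prod>j<i. (1 - 1 / real n) * (if j \<in> U then y else 1)) * (\<Prod>j\<in>{Suc i..<t}. c j)"
    if "Suc i \<le> t" for t
    using that
  proof (induction t rule: dec_induct)
    case base
    show ?case using \<open>measure_pmf.prob _ {h. D (Suc i) h} \<le> _\<close> by simp
  next
    case (step t)
    define Q where "Q h = {u. (u = fst (h ! i)) = (t \<in> U) \<and> (u = snd (h ! i)) = (t \<in> V)}" for h :: history
    have "measure_pmf.prob (history_pmf S n (Suc t)) {h. D (Suc t) h}
        \<le> c t * measure_pmf.prob (history_pmf S n t) {h. D t h}"
    proof (rule prob_history_Suc_le)
      fix h :: history and u v assume h: "h \<in> set_pmf (history_pmf S n t)" and D: "D (Suc t) (h @ [(u, v)])"
      then show "D t h \<and> u \<in> Q h"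
        using step.hyps length_history[OF h] by (auto simp: D_def Q_def nth_append atLeastLessThanSuc)
    next
      fix h assume h: "h \<in> set_pmf (history_pmf S n t)" and D: "D t h"
      define a b where "a = fst (h ! i)" "b = snd (h ! i)"
      have ab: "a \<noteq> b" "a \<in> {1..n}" "b \<in> {1..n}" using D by (auto simp: D_def a_b_def)
      have Q: "Q h = {u. (u = a) = (t \<in> U) \<and> (u = b) = (t \<in> V)}"
        by (simp add: Q_def a_b_def)
      consider "t \<in> U" "t \<in> V" | "t \<in> U" "t \<notin> V" | "t \<notin> U" "t \<in> V" | "t \<notin> U" "t \<notin> V" by blast
      then show "real (card ({1..n} \<inter> Q h)) \<le> c t * real n"
      proof cases
        case 1
        then have "{1..n} \<inter> Q h = {}" using ab by (auto simp: Q)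
        then show ?thesis using c_nonneg[of t] by simp
      next
        case 2
        then have "{1..n} \<inter> Q h = {a}" using ab by (auto simp: Q)
        then show ?thesis using 2 y by (simp add: c_def)
      next
        case 3
        then have "{1..n} \<inter> Q h = {b}" using ab by (auto simp: Q)
        then show ?thesis using 3 y by (simp add: c_def)
      next
        case 4
        then have "{1..n} \<inter> Q h = {1..n} - {a, b}" using ab by (auto simp: Q)
        moreover have "card ({1..n} - {a, b}) = n - 2"
          using ab by (subst card_Diff_subset) auto
        ultimately show ?thesis using 4 n by (simp add: c_def of_nat_diff field_simps)
      qed
    qed (use n c_nonneg in auto)
    also have "\<dots> \<le> c t * ((\<Prod>j<i. (1 - 1 / real n) * (if j \<in> U then y else 1)) * (\<Prod>j\<in>{Suc i..<t}. c j))"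
      using step.IH c_nonneg by (intro mult_left_mono) auto
    finally show ?case
      using step.hyps by (simp add: mult_ac)
  qed
  note T = this[of T]
  have "measure_pmf.prob (history_pmf S n T)
      {h. fst (h ! i) \<noteq> snd (h ! i) \<and> fst (h ! i) \<in> {1..n} \<and> snd (h ! i) \<in> {1..n}
        \<and> hits h (fst (h ! i)) = U \<and> hits h (snd (h ! i)) \<inter> {Suc i..<T} = V}
      \<le> measure_pmf.prob (history_pmf S n T) {h. D T h}"
    by (rule measure_pmf.finite_measure_mono_AE)
      (use i in \<open>auto intro!: AE_pmfI simp: D_def hits_def length_history\<close>)
  also have "\<dots> \<le> (\<Prod>j<i. (1 - 1 / real n) * (if j \<in> U then y else 1)) * (\<Prod>j\<in>{Suc i..<T}. c j)"
    using T i by simp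
  also have "\<dots> = (1 - 1 / real n) ^ i * (1 - 2 / real n) ^ (T - Suc i)
      * y ^ (card ({..<i} \<inter> U) + card ({Suc i..<T} \<inter> U)) * y ^ card ({Suc i..<T} \<inter> V)"
    by (simp add: c_def prod.distrib prod_if_mem_power power_add mult_ac)
  also have "{Suc i..<T} \<inter> V = V" using V by auto
  also have "card ({..<i} \<inter> U) + card ({Suc i..<T} \<inter> U) = card (({..<i} \<inter> U) \<union> ({Suc i..<T} \<inter> U))"
    by (rule card_Un_disjoint[symmetric]) auto
  also have "({..<i} \<inter> U) \<union> ({Suc i..<T} \<inter> U) = U - {i}"
    using U by auto
  also have "card (U - {i}) = card U - 1"
    using i by simp
  finally show ?thesis .
qed

text \<open>The events \<open>hits h v = U\<close> are disjoint. Raising the exponent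
  \<open>T - card U\<close> to \<open>T\<close> only lowers the sum and lets the common power factor
  out, leaving the generating polynomial at \<open>1 / n\<close>.\<close>

lemma prob_light_ge:
  assumes "v \<in> {1..n}" "K \<le> T"
  shows "(1 - 1 / real n) ^ T * (1 + real T * (1 / real n) + (\<Sum>j=0..<K. real (T - Suc j)) * (1 / real n)\<^sup>2)
    \<le> measure_pmf.prob (history_pmf S n T) {h. light K (hits h v)}"
proof -
  have n: "1 \<le> n" using assms by auto
  define L where "L = {U. U \<subseteq> {0..<T} \<and> light K U}"
  have fin: "finite L"
    unfolding L_def by (rule finite_light)
  have "(1 - 1 / real n) ^ T * (1 + real (T - 0) * (1 / real n) + (\<Sum>j=0..<K. real (T - Suc j)) * (1 / real n)\<^sup>2)
      = (\<Sum>U\<in>L. (1 / real n) ^ card U * (1 - 1 / real n) ^ T)"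
    unfolding L_def sum_light[OF assms(2), symmetric] by (simp add: sum_distrib_left mult.commute)
  also have "\<dots> \<le> (\<Sum>U\<in>L. (1 / real n) ^ card U * (1 - 1 / real n) ^ (T - card U))"
    using n by (intro sum_mono mult_left_mono power_decreasing) auto
  also have "\<dots> = (\<Sum>U\<in>L. measure_pmf.prob (history_pmf S n T) {h. hits h v = U})"
    by (rule sum.cong) (use assms(1) in \<open>auto simp: L_def prob_hits_eq lessThan_atLeast0\<close>)
  also have "\<dots> = measure_pmf.prob (history_pmf S n T) (\<Union>U\<in>L. {h. hits h v = U})"
    by (rule measure_pmf.finite_measure_finite_Union[symmetric])
      (use fin in \<open>auto simp: disjoint_family_on_def\<close>)
  also have "\<dots> \<le> measure_pmf.prob (history_pmf S n T) {h. light K (hits h v)}"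
    by (rule measure_pmf.finite_measure_mono) (auto simp: L_def)
  finally show ?thesis by simp
qed

text \<open>A union bound over the full hit set of the random endpoint and the later hit set of the
  chosen one, which is light by \<open>light_subset\<close>. The resulting weights factor into the
  two generating sums.\<close>

lemma prob_light_edge_le:
  assumes n: "3 \<le> n" and i: "i < T" and K: "K \<le> T"
  defines "y \<equiv> 1 / (real n - 2)"
  shows "measure_pmf.prob (history_pmf S n T)
      {h. fst (h ! i) \<noteq> snd (h ! i) \<and> light K (hits h (fst (h ! i))) \<and> light K (hits h (snd (h ! i)))
        \<and> fst (h ! i) \<in> {1..n} \<and> snd (h ! i) \<in> {1..n}}
    \<le> (1 - 1 / real n) ^ i * (1 - 2 / real n) ^ (T - Suc i) * (1 + real (if i < K then T else K) * y)
      * (1 + real (T - Suc i) * y + (\<Sum>j=Suc i..<K. real (T - Suc j)) * y\<^sup>2)"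
    (is "measure_pmf.prob _ {h. ?E h} \<le> _")
proof -
  define U where "U = {U. U \<subseteq> {0..<T} \<and> light K U \<and> i \<in> U}"
  define V where "V = {V. V \<subseteq> {Suc i..<T} \<and> light K V}"
  define F where "F = (\<lambda>(U, V). {h. fst (h ! i) \<noteq> snd (h ! i) \<and> fst (h ! i) \<in> {1..n} \<and> snd (h ! i) \<in> {1..n}
        \<and> hits h (fst (h ! i)) = U \<and> hits h (snd (h ! i)) \<inter> {Suc i..<T} = V})"
  define a where "a = (1 - 1 / real n) ^ i * (1 - 2 / real n) ^ (T - Suc i)"
  have fin: "finite U" "finite V"
    using finite_light[of 0 T K] finite_light[of "Suc i" T K]
    by (auto simp: U_def V_def elim: finite_subset[rotated])
  have y: "0 \<le> y" "0 \<le> a" using n by (auto simp: y_def a_def)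
  have "measure_pmf.prob (history_pmf S n T) {h. ?E h}
      \<le> measure_pmf.prob (history_pmf S n T) (\<Union>p\<in>U \<times> V. F p)"
  proof (rule measure_pmf.finite_measure_mono_AE)
    have "h \<in> (\<Union>p\<in>U \<times> V. F p)" if h: "h \<in> set_pmf (history_pmf S n T)" and E: "?E h" for h
    proof -
      have len: "length h = T" using length_history[OF h] .
      have "hits h (fst (h ! i)) \<in> U"
        using E i len by (auto simp: U_def hits_def)
      moreover have "hits h (snd (h ! i)) \<inter> {Suc i..<T} \<in> V"
        using E light_subset[of K "hits h (snd (h ! i))"] by (auto simp: V_def)
      ultimately show ?thesis
        using E by (intro UN_I[of "(hits h (fst (h ! i)), hits h (snd (h ! i)) \<inter> {Suc i..<T})"]) (auto simp: F_def)
    qed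
    then show "AE h in history_pmf S n T. h \<in> {h. ?E h} \<longrightarrow> h \<in> (\<Union>p\<in>U \<times> V. F p)"
      by (intro AE_pmfI) blast
  qed simp
  also have "\<dots> \<le> (\<Sum>p\<in>U \<times> V. measure_pmf.prob (history_pmf S n T) (F p))"
    by (rule measure_pmf.finite_measure_subadditive_finite) (use fin in auto)
  also have "\<dots> \<le> (\<Sum>(u, v)\<in>U \<times> V. a * y ^ (card u - 1) * y ^ card v)"
  proof (rule sum_mono)
    fix p assume "p \<in> U \<times> V"
    then obtain u v where p: "p = (u, v)" "u \<in> U" "v \<in> V" by auto
    then have "measure_pmf.prob (history_pmf S n T) (F p) \<le> a * y ^ (card u - 1) * y ^ card v"
      using prob_hits_edge_le[OF n i, of u v S] by (simp add: F_def U_def V_def a_def y_def)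
    then show "measure_pmf.prob (history_pmf S n T) (F p) \<le> (case p of (u, v) \<Rightarrow> a * y ^ (card u - 1) * y ^ card v)"
      using p by simp
  qed
  also have "\<dots> = (\<Sum>u\<in>U. \<Sum>v\<in>V. a * y ^ (card u - 1) * y ^ card v)"
    by (rule sum.cartesian_product[symmetric])
  also have "\<dots> = a * (\<Sum>u\<in>U. y ^ (card u - 1)) * (\<Sum>v\<in>V. y ^ card v)"
    by (simp only: sum_distrib_left[symmetric] sum_distrib_right[symmetric])
  also have "\<dots> \<le> a * (1 + real (if i < K then T else K) * y) * (\<Sum>v\<in>V. y ^ card v)"
    unfolding U_def using y by (intro mult_right_mono mult_left_mono sum_light_through i K sum_nonneg) auto
  also have "(\<Sum>v\<in>V. y ^ card v) = 1 + real (T - Suc i) * y + (\<Sum>j=Suc i..<K. real (T - Suc j)) * y\<^sup>2"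
    unfolding V_def by (rule sum_light[OF K])
  finally show ?thesis unfolding a_def .
qed

text \<open>Expectation of \<open>HAM_size_bound\<close> with \<open>L\<close> the lightness of the
  hit set, by linearity.\<close>

lemma HAM_prob_le:
  assumes n: "3 \<le> n" and K: "K \<le> T"
  defines "x \<equiv> 1 / real n" and "y \<equiv> 1 / (real n - 2)"
  shows "real n * measure_pmf.prob (history_pmf S n T) {h. HAM n (graph_of h)}
    \<le> 2 * real n * (1 - (1 - x) ^ T * (1 + real T * x + (\<Sum>j=0..<K. real (T - Suc j)) * x\<^sup>2))
      + (\<Sum>i<T. (1 - x) ^ i * (1 - 2 * x) ^ (T - Suc i) * (1 + real (if i < K then T else K) * y)
          * (1 + real (T - Suc i) * y + (\<Sum>j=Suc i..<K. real (T - Suc j)) * y\<^sup>2))"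
proof -
  define M where "M = measure_pmf (history_pmf S n T)"
  define A where "A v = {h. light K (hits h v)}" for v
  define E where "E i = {h :: history. fst (h ! i) \<noteq> snd (h ! i) \<and> light K (hits h (fst (h ! i)))
    \<and> light K (hits h (snd (h ! i))) \<and> fst (h ! i) \<in> {1..n} \<and> snd (h ! i) \<in> {1..n}}" for i
  have int: "integrable M (indicator X :: history \<Rightarrow> real)" for X
    unfolding M_def by (simp add: integrable_indicator_iff measure_pmf.emeasure_eq_measure)
  have E_ind: "(\<integral>h. indicator X h \<partial>M) = measure_pmf.prob (history_pmf S n T) X" for X
    unfolding M_def by simp
  \<comment> \<open>Without a Hamiltonian cycle the left side is 0, and the right side is never
    negative.\<close>
  have "real n * indicator {h. HAM n (graph_of h)} h
      \<le> 2 * (real n - (\<Sum>v\<in>{1..n}. indicator (A v) h)) + (\<Sum>i<T. indicator (E i) h)"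
    if h: "h \<in> set_pmf (history_pmf S n T)" for h
  proof -
    have len: "length h = T" using length_history[OF h] .
    have sA: "(\<Sum>v\<in>{1..n}. indicator (A v) h) = real (card {v \<in> {1..n}. light K (hits h v)})"
      by (simp add: A_def indicator_def sum.If_cases Int_def)
    have sE: "(\<Sum>i<T. indicator (E i) h) = real (card {i. i < T \<and> h \<in> E i})"
      by (simp add: indicator_def sum.If_cases Int_def)
    have "{v \<in> {1..n}. \<not> light K (hits h v)} = {1..n} - {v \<in> {1..n}. light K (hits h v)}"
      by auto
    then have "card {v \<in> {1..n}. \<not> light K (hits h v)} = n - card {v \<in> {1..n}. light K (hits h v)}"
      using card_Diff_subset[of "{v \<in> {1..n}. light K (hits h v)}" "{1..n}"] by (simp add: subset_iff)
    moreover have le: "card {v \<in> {1..n}. light K (hits h v)} \<le> n"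
      using card_mono[of "{1..n}" "{v \<in> {1..n}. light K (hits h v)}"] by (auto simp: subset_iff)
    ultimately have c: "real (card {v \<in> {1..n}. \<not> light K (hits h v)})
        = real n - real (card {v \<in> {1..n}. light K (hits h v)})"
      by (simp add: of_nat_diff)
    show ?thesis
    proof (cases "HAM n (graph_of h)")
      case True
      then have "n \<le> 2 * card {v \<in> {1..n}. \<not> light K (hits h v)} + card {i. i < T \<and> h \<in> E i}"
        using HAM_size_bound[of n h "\<lambda>v. light K (hits h v)"] n len by (simp add: E_def)
      then show ?thesis
        unfolding sA sE c[symmetric] using True by simp
    next
      case False
      then show ?thesis unfolding sA sE using le by simp
    qed
  qed
  then have ae: "AE h in M. real n * indicator {h. HAM n (graph_of h)} h
      \<le> 2 * (real n - (\<Sum>v\<in>{1..n}. indicator (A v) h)) + (\<Sum>i<T. indicator (E i) h)"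
    unfolding M_def by (rule AE_pmfI)
  have const: "integrable M (\<lambda>h. real n)" "(\<integral>h. real n \<partial>M) = real n"
    unfolding M_def by simp_all
  have lin: "(\<integral>h. 2 * (real n - f h) + g h \<partial>M) = 2 * (real n - (\<integral>h. f h \<partial>M)) + (\<integral>h. g h \<partial>M)"
    if "integrable M f" "integrable M g" for f g
  proof -
    have "integrable M (\<lambda>h. 2 * (real n - f h))"
      using that const(1) by (intro integrable_mult_right Bochner_Integration.integrable_diff)
    then show ?thesis
      by (simp only: Bochner_Integration.integral_add[OF _ that(2)] integral_mult_right_zero
          Bochner_Integration.integral_diff[OF const(1) that(1)] const(2))
  qed
  have sums: "integrable M (\<lambda>h. \<Sum>v\<in>{1..n}. indicator (A v) h :: real)"
    "integrable M (\<lambda>h. \<Sum>i<T. indicator (E i) h :: real)"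
    by (intro Bochner_Integration.integrable_sum int)+
  have "real n * measure_pmf.prob (history_pmf S n T) {h. HAM n (graph_of h)}
      = (\<integral>h. real n * indicator {h. HAM n (graph_of h)} h \<partial>M)"
    by (simp only: integral_mult_right_zero E_ind)
  also have "\<dots> \<le> (\<integral>h. 2 * (real n - (\<Sum>v\<in>{1..n}. indicator (A v) h)) + (\<Sum>i<T. indicator (E i) h) \<partial>M)"
    by (intro integral_mono_AE ae sums Bochner_Integration.integrable_add Bochner_Integration.integrable_diff
        integrable_mult_right int const(1))
  also have "\<dots> = 2 * (real n - (\<integral>h. (\<Sum>v\<in>{1..n}. indicator (A v) h) \<partial>M))
      + (\<integral>h. (\<Sum>i<T. indicator (E i) h) \<partial>M)"
    by (rule lin[OF sums])
  also have "\<dots> = 2 * (real n - (\<Sum>v\<in>{1..n}. measure_pmf.prob (history_pmf S n T) (A v)))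
        + (\<Sum>i<T. measure_pmf.prob (history_pmf S n T) (E i))"
    by (simp only: Bochner_Integration.integral_sum[OF int] E_ind)
  also have "\<dots> \<le> 2 * (real n - (\<Sum>v\<in>{1..n}. (1 - x) ^ T * (1 + real T * x + (\<Sum>j=0..<K. real (T - Suc j)) * x\<^sup>2)))
      + (\<Sum>i<T. (1 - x) ^ i * (1 - 2 * x) ^ (T - Suc i) * (1 + real (if i < K then T else K) * y)
          * (1 + real (T - Suc i) * y + (\<Sum>j=Suc i..<K. real (T - Suc j)) * y\<^sup>2))"
    using prob_light_ge[OF _ K, of _ n S] prob_light_edge_le[OF n _ K, of _ S]
    by (intro add_mono mult_left_mono diff_left_mono sum_mono) (simp_all add: A_def E_def x_def y_def)
  finally show ?thesis
    by (simp add: right_diff_distrib)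
qed

section \<open>Asymptotics of the bound\<close>

text \<open>The number of pairs among the last \<open>T - a\<close> steps minus the number among the
  last \<open>T - K\<close>.\<close>

lemma sum_falling:
  assumes "a \<le> K" "K \<le> T"
  shows "(\<Sum>j=a..<K. real (T - Suc j))
    = ((real T - real a) * (real T - real a - 1) - (real T - real K) * (real T - real K - 1)) / 2"
  using assms
proof (induction K rule: dec_induct)
  case (step K)
  then have "real (T - Suc K) = real T - real K - 1" by (simp add: of_nat_diff)
  with step show ?case by (simp add: sum.atLeastLessThan_Suc field_simps)
qed simp

text \<open>For a decreasing integrand the Riemann sum at right endpoints is below the integral; the
  mean value theorem compares each term with the increment of \<open>F\<close>.\<close>

lemma right_sum_le_antiderivative:
  fixes F g :: "real \<Rightarrow> real"
  assumes "\<And>r. a \<le> r \<Longrightarrow> (F has_real_derivative g r) (at r)"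
    and anti: "\<And>r r'. a \<le> r \<Longrightarrow> r \<le> r' \<Longrightarrow> g r' \<le> g r" and "0 < x"
  shows "(\<Sum>i<k. g (a + x * real (Suc i))) * x \<le> F (a + x * real k) - F a"
proof (induction k)
  case (Suc k)
  let ?l = "a + x * real k" and ?u = "a + x * real (Suc k)"
  have lu: "a \<le> ?l" "?l < ?u" using assms(3) by (auto simp: field_simps)
  obtain z where z: "?l < z" "z < ?u" "F ?u - F ?l = (?u - ?l) * g z"
    using MVT2[OF lu(2), of F g] assms(1) lu(1) by (meson order.trans)
  have "a \<le> z" using lu(1) z(1) by linarith
  then have "g ?u * x \<le> g z * x"
    using z(2) anti[of z ?u] assms(3) by (intro mult_right_mono) auto
  also have "\<dots> = F ?u - F ?l"
    using z(3) by (simp add: algebra_simps)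
  finally show ?case using Suc by (simp add: distrib_right)
qed simp

lemma exp_linear_antimono:
  fixes r r' :: real
  assumes "0 \<le> r" "r \<le> r'"
  shows "exp (- r') * (1 + r') \<le> exp (- r) * (1 + r)"
proof (rule DERIV_nonpos_imp_nonincreasing[OF assms(2)])
  fix z assume "r \<le> z" "z \<le> r'"
  moreover have "((\<lambda>r. exp (- r) * (1 + r)) has_real_derivative - exp (- z) * z) (at z)"
    by (auto intro!: derivative_eq_intros simp: algebra_simps)
  ultimately show "\<exists>y. ((\<lambda>r. exp (- r) * (1 + r)) has_real_derivative y) (at z) \<and> y \<le> 0"
    using assms(1) by (intro exI[of _ "- exp (- z) * z"]) auto
qed

lemma exp_quadratic_antimono:
  fixes m r r' :: real
  assumes "0 \<le> m" "m \<le> r" "r \<le> r'"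
  shows "exp (- r') * (1 + r' + (r'\<^sup>2 - m\<^sup>2) / 2) \<le> exp (- r) * (1 + r + (r\<^sup>2 - m\<^sup>2) / 2)"
proof (rule DERIV_nonpos_imp_nonincreasing[OF assms(3)])
  fix z assume z: "r \<le> z" "z \<le> r'"
  have "((\<lambda>r. exp (- r) * (1 + r + (r\<^sup>2 - m\<^sup>2) / 2)) has_real_derivative - exp (- z) * ((z\<^sup>2 - m\<^sup>2) / 2)) (at z)"
    by (auto intro!: derivative_eq_intros simp: field_simps)
  moreover have "m\<^sup>2 \<le> z\<^sup>2"
    using z assms by (intro power_mono) auto
  then have "- exp (- z) * ((z\<^sup>2 - m\<^sup>2) / 2) \<le> 0"
    by (intro mult_nonpos_nonneg) auto
  ultimately show "\<exists>y. ((\<lambda>r. exp (- r) * (1 + r + (r\<^sup>2 - m\<^sup>2) / 2)) has_real_derivative y) (at z) \<and> y \<le> 0"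
    by blast
qed

text \<open>
  Up to factors that tend to 1, a step at time \<open>s - r\<close> joins two light vertices with
  probability \<open>exp (- s) * exp (- r) * (1 + r + c) * w\<close>.  Before time \<open>s - m\<close> we have
  \<open>c = (r\<^sup>2 - m\<^sup>2) / 2\<close> and \<open>w = 1 + s\<close>, after it \<open>c = 0\<close> and \<open>w = 1 + s - m\<close>.
  The integrals of \<open>exp (- r) * (1 + r + c)\<close> over \<open>{m..s}\<close> and \<open>{0..m}\<close> are the following.
\<close>

definition early_integral :: "real \<Rightarrow> real \<Rightarrow> real" where
  "early_integral s m = exp (- m) * (3 + 2 * m) - exp (- s) * (3 + 2 * s + (s\<^sup>2 - m\<^sup>2) / 2)"

definition late_integral :: "real \<Rightarrow> real" where
  "late_integral m = 2 - exp (- m) * (2 + m)"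

text \<open>Here \<open>x = 1 / n\<close>, and \<open>s - m\<close> is the time \<open>K / n\<close>.\<close>

definition ham_bound :: "real \<Rightarrow> real \<Rightarrow> real \<Rightarrow> real" where
  "ham_bound s m x =
     2 * (1 - exp (- s - 2 * s * x) * (1 + s + (s\<^sup>2 - m\<^sup>2) / 2 - (s - m) * x / 2))
     + (1 / (1 - 2 * x)) ^ 3 * exp (2 * x) * exp (- s)
       * ((1 + s) * early_integral s m + (1 + s - m) * late_integral m)"

text \<open>Multiplied by \<open>x\<close>, the sum is a Riemann sum of mesh \<open>x\<close> in the
  remaining time \<open>r i\<close>. Passing from \<open>y\<close> to \<open>x\<close> costs one
  factor \<open>\<rho> = 1 / (1 - 2 * x)\<close> for the random endpoint and two for the chosen
  one.\<close>

lemma edge_sum_le: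
  fixes n K T :: nat
  assumes n: "3 \<le> n" and K: "K \<le> T"
  defines "x \<equiv> 1 / real n" and "y \<equiv> 1 / (real n - 2)"
  defines "s \<equiv> real T / real n" and "m \<equiv> (real T - real K) / real n"
  shows "(\<Sum>i<T. (1 - x) ^ i * (1 - 2 * x) ^ (T - Suc i) * (1 + real (if i < K then T else K) * y)
          * (1 + real (T - Suc i) * y + (\<Sum>j=Suc i..<K. real (T - Suc j)) * y\<^sup>2)) * x
    \<le> (1 / (1 - 2 * x)) ^ 3 * exp (2 * x) * exp (- s)
       * ((1 + s) * early_integral s m + (1 + s - m) * late_integral m)"
    (is "(\<Sum>i<T. ?t i) * x \<le> _")
proof -
  define \<rho> where "\<rho> = 1 / (1 - 2 * x)"
  \<comment> \<open>\<open>w i\<close> and \<open>g i\<close> are the limits of the two generating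
    sums: \<open>w i\<close> belongs to the random endpoint, \<open>g i\<close> to the hits of the
    chosen one in the remaining time \<open>r i\<close>.\<close>
  define r where "r i = (real T - real i) / real n" for i
  define w where "w i = (if i < K then 1 + s else 1 + s - m)" for i
  define g where "g i = (if i < K then 1 + r i + ((r i)\<^sup>2 - m\<^sup>2) / 2 else 1 + r i)" for i
  have x: "0 < x" "x < 1 / 2" using n by (auto simp: x_def field_simps)
  have \<rho>: "1 \<le> \<rho>" using x by (simp add: \<rho>_def)
  have y: "y = \<rho> * x" using n by (simp add: y_def \<rho>_def x_def field_simps)
  have s: "0 \<le> s" "0 \<le> m" "m \<le> s" using K n by (auto simp: s_def m_def field_simps)
  have Tx: "real T * x = s" "real K * x = s - m"
    using n by (auto simp: s_def m_def x_def field_simps)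
  have t: "?t i \<le> \<rho> ^ 3 * exp (2 * x) * exp (- s) * (exp (- r i) * g i * w i)" if i: "i < T" for i
  proof -
    have "(1 - x) ^ i \<le> exp (- x) ^ i"
      using x exp_ge_add_one_self[of "- x"] by (intro power_mono) auto
    moreover have "(1 - 2 * x) ^ (T - Suc i) \<le> exp (- 2 * x) ^ (T - Suc i)"
      using x exp_ge_add_one_self[of "- 2 * x"] by (intro power_mono) auto
    ultimately have "(1 - x) ^ i * (1 - 2 * x) ^ (T - Suc i) \<le> exp (- x) ^ i * exp (- 2 * x) ^ (T - Suc i)"
      using x by (intro mult_mono) auto
    also have "\<dots> = exp (2 * x) * exp (- s) * exp (- r i)"
    proof -
      \<comment> \<open>Avoiding one vertex all the time gives \<open>s\<close>, avoiding a second
        one after step \<open>i\<close> gives \<open>r i\<close>; step \<open>i\<close> itself is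
        exempt from both, which leaves \<open>2 * x\<close>.\<close>
      have "real i * (- x) + real (T - Suc i) * (- 2 * x) = 2 * x + (- s) + (- r i)"
        using i n by (simp add: of_nat_diff s_def r_def x_def field_simps)
      then show ?thesis by (simp only: exp_of_nat_mult[symmetric] exp_add[symmetric])
    qed
    finally have p: "(1 - x) ^ i * (1 - 2 * x) ^ (T - Suc i) \<le> exp (2 * x) * exp (- s) * exp (- r i)" .
    have "1 + real (if i < K then T else K) * y = 1 + \<rho> * (w i - 1)"
      using Tx by (simp add: w_def y mult.left_commute)
    also have "\<dots> \<le> \<rho> * w i"
      using \<rho> by (simp add: algebra_simps)
    finally have w: "1 + real (if i < K then T else K) * y \<le> \<rho> * w i" .
    have Ti: "real (T - Suc i) * x \<le> r i"
      using i n by (simp add: r_def x_def field_simps)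
    have N: "(\<Sum>j=Suc i..<K. real (T - Suc j)) * x\<^sup>2 \<le> g i - 1 - r i"
    proof (cases "i < K")
      case True
      have "(A - 1) * (A - 2) - B * (B - 1) \<le> A\<^sup>2 - B\<^sup>2" if "B + 1 \<le> A" "0 \<le> B" for A B :: real
        using that by (simp add: power2_eq_square algebra_simps)
      from this[of "real T - real K" "real T - real i"]
      have "(\<Sum>j=Suc i..<K. real (T - Suc j)) \<le> ((real T - real i)\<^sup>2 - (real T - real K)\<^sup>2) / 2"
        using True K by (subst sum_falling) (auto simp: diff_diff_eq add.commute)
      then have "(\<Sum>j=Suc i..<K. real (T - Suc j)) * x\<^sup>2
          \<le> ((real T - real i)\<^sup>2 - (real T - real K)\<^sup>2) / 2 * x\<^sup>2"
        by (rule mult_right_mono) simp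
      also have "\<dots> = ((r i)\<^sup>2 - m\<^sup>2) / 2"
        unfolding r_def m_def x_def power_divide by (simp add: diff_divide_distrib left_diff_distrib)
      finally show ?thesis using True by (simp add: g_def)
    qed (simp add: g_def)
    have "1 + real (T - Suc i) * y + (\<Sum>j=Suc i..<K. real (T - Suc j)) * y\<^sup>2
        = 1 + \<rho> * (real (T - Suc i) * x) + \<rho>\<^sup>2 * ((\<Sum>j=Suc i..<K. real (T - Suc j)) * x\<^sup>2)"
      by (simp add: y power_mult_distrib mult_ac)
    also have "\<dots> \<le> \<rho>\<^sup>2 * 1 + \<rho>\<^sup>2 * r i + \<rho>\<^sup>2 * (g i - 1 - r i)"
      using \<rho> Ti N x by (intro add_mono mult_mono) (auto simp: power2_eq_square mult_ge1_I sum_nonneg)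
    also have "\<dots> = \<rho>\<^sup>2 * g i" by (simp add: algebra_simps)
    finally have v: "1 + real (T - Suc i) * y + (\<Sum>j=Suc i..<K. real (T - Suc j)) * y\<^sup>2 \<le> \<rho>\<^sup>2 * g i" .
    have y0: "0 \<le> y" using \<rho> x y by simp
    have w0: "0 \<le> w i" using s by (simp add: w_def)
    have "?t i \<le> exp (2 * x) * exp (- s) * exp (- r i) * (\<rho> * w i) * (\<rho>\<^sup>2 * g i)"
      using \<rho> x y0 w0 by (intro mult_mono p w v mult_nonneg_nonneg add_nonneg_nonneg sum_nonneg) auto
    also have "\<dots> = \<rho> ^ 3 * exp (2 * x) * exp (- s) * (exp (- r i) * g i * w i)"
      by (simp add: power3_eq_cube power2_eq_square mult_ac)
    finally show ?thesis .
  qed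
  have early: "(\<Sum>i<K. exp (- r i) * g i) * x \<le> early_integral s m"
  proof -
    define f where "f r = exp (- r) * (1 + r + (r\<^sup>2 - m\<^sup>2) / 2)" for r
    define F where "F r = - exp (- r) * (3 + 2 * r + (r\<^sup>2 - m\<^sup>2) / 2)" for r
    \<comment> \<open>Remaining time decreases in \<open>i\<close>; reversing the order turns the
      sum into one at right endpoints of a partition of the interval from \<open>m\<close> to
      \<open>s\<close>.\<close>
    have "(\<Sum>i<K. exp (- r i) * g i) = (\<Sum>i<K. f (m + x * real (Suc (K - Suc i))))"
    proof (rule sum.cong)
      fix i assume "i \<in> {..<K}"
      then have "r i = m + x * real (Suc (K - Suc i))"
        using n by (simp add: r_def m_def x_def field_simps Suc_diff_Suc of_nat_diff)
      then show "exp (- r i) * g i = f (m + x * real (Suc (K - Suc i)))"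
        using \<open>i \<in> {..<K}\<close> by (simp add: f_def g_def)
    qed simp
    also have "\<dots> = (\<Sum>i<K. f (m + x * real (Suc i)))"
      by (rule sum.nat_diff_reindex)
    also have "\<dots> * x \<le> F (m + x * real K) - F m"
    proof (rule right_sum_le_antiderivative[OF _ _ x(1)])
      show "(F has_real_derivative f r) (at r)" for r
        unfolding F_def f_def by (auto intro!: derivative_eq_intros simp: field_simps)
      show "f r' \<le> f r" if "m \<le> r" "r \<le> r'" for r r'
        unfolding f_def using exp_quadratic_antimono[OF s(2) that] .
    qed
    also have "m + x * real K = s" using Tx by (simp add: mult.commute)
    finally show ?thesis by (simp add: F_def early_integral_def)
  qed
  have late: "(\<Sum>i\<in>{K..<T}. exp (- r i) * g i) * x \<le> late_integral m"
  proof -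
    define f where "f r = exp (- r) * (1 + r)" for r :: real
    define F where "F r = - exp (- r) * (2 + r)" for r :: real
    have "(\<Sum>i\<in>{K..<T}. exp (- r i) * g i) = (\<Sum>i<T - K. exp (- r (i + K)) * g (i + K))"
      using sum.shift_bounds_nat_ivl[of "\<lambda>i. exp (- r i) * g i" 0 K "T - K"] K
      by (simp add: lessThan_atLeast0)
    also have "\<dots> = (\<Sum>i<T - K. f (0 + x * real (Suc (T - K - Suc i))))"
    proof (rule sum.cong)
      fix i assume "i \<in> {..<T - K}"
      then have "r (i + K) = 0 + x * real (Suc (T - K - Suc i))"
        using n by (simp add: r_def x_def field_simps Suc_diff_Suc of_nat_diff)
      then show "exp (- r (i + K)) * g (i + K) = f (0 + x * real (Suc (T - K - Suc i)))"
        by (simp add: f_def g_def)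
    qed simp
    also have "\<dots> = (\<Sum>i<T - K. f (0 + x * real (Suc i)))"
      by (rule sum.nat_diff_reindex)
    also have "\<dots> * x \<le> F (0 + x * real (T - K)) - F 0"
    proof (rule right_sum_le_antiderivative[OF _ _ x(1)])
      show "(F has_real_derivative f r) (at r)" for r
        unfolding F_def f_def by (auto intro!: derivative_eq_intros simp: field_simps)
      show "f r' \<le> f r" if "0 \<le> r" "r \<le> r'" for r r'
        unfolding f_def using exp_linear_antimono[OF that] .
    qed
    also have "0 + x * real (T - K) = m" using K by (simp add: x_def m_def of_nat_diff)
    finally show ?thesis by (simp add: F_def late_integral_def)
  qed
  have split: "(\<Sum>i<T. f i) = (\<Sum>i<K. f i) + (\<Sum>i\<in>{K..<T}. f i)" for f :: "nat \<Rightarrow> real"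
    using K by (metis lessThan_atLeast0 sum.atLeastLessThan_concat zero_le)
  have "(\<Sum>i<T. ?t i) * x \<le> (\<Sum>i<T. \<rho> ^ 3 * exp (2 * x) * exp (- s) * (exp (- r i) * g i * w i)) * x"
    using t x by (intro mult_right_mono sum_mono) auto
  also have "\<dots> = \<rho> ^ 3 * exp (2 * x) * exp (- s) * ((\<Sum>i<T. exp (- r i) * g i * w i) * x)"
    by (simp add: sum_distrib_left mult.assoc)
  also have "(\<Sum>i<T. exp (- r i) * g i * w i) * x
      = (1 + s) * ((\<Sum>i<K. exp (- r i) * g i) * x) + (1 + s - m) * ((\<Sum>i\<in>{K..<T}. exp (- r i) * g i) * x)"
  proof -
    have "(\<Sum>i<K. exp (- r i) * g i * w i) = (1 + s) * (\<Sum>i<K. exp (- r i) * g i)"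
      unfolding sum_distrib_left by (rule sum.cong) (auto simp: w_def)
    moreover have "(\<Sum>i\<in>{K..<T}. exp (- r i) * g i * w i) = (1 + s - m) * (\<Sum>i\<in>{K..<T}. exp (- r i) * g i)"
      unfolding sum_distrib_left by (rule sum.cong) (auto simp: w_def)
    ultimately show ?thesis
      unfolding split by (simp only: distrib_right mult.assoc)
  qed
  also have "\<rho> ^ 3 * exp (2 * x) * exp (- s) * \<dots> \<le> \<rho> ^ 3 * exp (2 * x) * exp (- s)
      * ((1 + s) * early_integral s m + (1 + s - m) * late_integral m)"
    using early late s \<rho> by (intro mult_left_mono add_mono) auto
  finally show ?thesis by (simp add: \<rho>_def)
qed

text \<open>\<open>HAM_prob_le\<close> divided by \<open>n\<close>. The edge term is
  \<open>edge_sum_le\<close>; the vertex term needs a lower bound on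
  \<open>(1 - x) ^ T\<close>.\<close>

lemma HAM_prob_le_ham_bound:
  assumes n: "3 \<le> n" and K: "K \<le> T"
  shows "measure_pmf.prob (history_pmf S n T) {h. HAM n (graph_of h)}
    \<le> ham_bound (real T / real n) ((real T - real K) / real n) (1 / real n)"
proof -
  define x s m where "x = 1 / real n" "s = real T / real n" "m = (real T - real K) / real n"
  note defs = x_s_m_def
  let ?t = "\<lambda>i. (1 - x) ^ i * (1 - 2 * x) ^ (T - Suc i) * (1 + real (if i < K then T else K) * (1 / (real n - 2)))
          * (1 + real (T - Suc i) * (1 / (real n - 2)) + (\<Sum>j=Suc i..<K. real (T - Suc j)) * (1 / (real n - 2))\<^sup>2)"
  let ?l = "1 + s + (s\<^sup>2 - m\<^sup>2) / 2 - (s - m) * x / 2"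
  have x: "0 < x" "x < 1 / 2" "real n * x = 1" using n by (auto simp: defs field_simps)
  have l: "1 + real T * x + (\<Sum>j=0..<K. real (T - Suc j)) * x\<^sup>2 = ?l"
    using n K by (subst sum_falling) (auto simp: defs power2_eq_square field_simps)
  have l0: "0 \<le> ?l"
    unfolding l[symmetric] using x by (intro add_nonneg_nonneg mult_nonneg_nonneg sum_nonneg) auto
  \<comment> \<open>This is \<open>ln (1 - x) \<ge> - x - 2 * x^2\<close>, valid for
    \<open>x \<le> 1 / 2\<close>.\<close>
  have "exp (- x - 2 * x\<^sup>2) \<le> 1 - x"
    using ln_one_minus_pos_lower_bound[of x] x by (subst ln_ge_iff[symmetric]) auto
  then have "exp (- x - 2 * x\<^sup>2) ^ T \<le> (1 - x) ^ T"
    by (rule power_mono) simp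
  also have "exp (- x - 2 * x\<^sup>2) ^ T = exp (- s - 2 * s * x)"
    by (subst exp_of_nat_mult[symmetric]) (simp add: defs power2_eq_square algebra_simps)
  finally have e: "exp (- s - 2 * s * x) * ?l \<le> (1 - x) ^ T * ?l"
    using l0 by (rule mult_right_mono)
  let ?P = "measure_pmf.prob (history_pmf S n T) {h. HAM n (graph_of h)}"
  have scale: "(2 * real n * a + b) * x = 2 * a + b * x" for a b
  proof -
    have "(2 * real n * a + b) * x = 2 * a * (real n * x) + b * x" by (simp add: algebra_simps)
    then show ?thesis using x(3) by simp
  qed
  have "?P = real n * ?P * x" using x by (simp add: mult.commute mult.left_commute)
  also have "\<dots> \<le> (2 * real n * (1 - (1 - x) ^ T * ?l) + (\<Sum>i<T. ?t i)) * x"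
    using HAM_prob_le[OF n K, of S] x unfolding defs(1)[symmetric] l by (intro mult_right_mono) auto
  also have "\<dots> = 2 * (1 - (1 - x) ^ T * ?l) + (\<Sum>i<T. ?t i) * x"
    by (rule scale)
  also have "\<dots> \<le> ham_bound s m x"
    unfolding ham_bound_def using e edge_sum_le[OF n K] unfolding defs[symmetric] by (intro add_mono mult_left_mono) auto
  finally show ?thesis unfolding defs .
qed

section \<open>Evaluation of the limiting bound\<close>

lemma ham_bound_0_less: "ham_bound (127 / 100) (9 / 10) 0 < 1"
proof -
  define E D :: real where "E = exp (- (127 / 100))" and "D = exp (- (9 / 10))"
  have E: "280831 / 1000000 \<le> E" "E \<le> 280832 / 1000000"
    and D: "406569 / 1000000 \<le> D" "D \<le> 40657 / 100000"
    using exp_127_bounds exp_09_bounds by (auto simp: E_def D_def)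
  \<comment> \<open>In the expansion below \<open>E * D\<close> has a positive coefficient,
    \<open>E\<close> and \<open>E\<^sup>2\<close> have negative ones. The value is about
    0.996.\<close>
  have "E * D \<le> 280832 / 1000000 * (40657 / 100000)" "(280831 / 1000000)\<^sup>2 \<le> E\<^sup>2"
    using E D by (intro mult_mono power_mono; simp)+
  then have "E * D \<le> 114178 / 1000000" "78866 / 1000000 \<le> E\<^sup>2"
    by (simp_all add: power2_eq_square)
  moreover have "ham_bound (127 / 100) (9 / 10) 0
    = 2 - 26029 / 10000 * E + 6923 / 1000 * (E * D) - 26974183 / 2000000 * E\<^sup>2"
    unfolding ham_bound_def early_integral_def late_integral_def
    by (simp add: E_def[symmetric] D_def[symmetric] power2_eq_square field_simps)
  ultimately show ?thesis
    using E D by linarith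
qed

lemma ham_bound_tendsto: "(ham_bound s m \<longlongrightarrow> ham_bound s m 0) (at 0)"
  unfolding ham_bound_def[abs_def] by (intro tendsto_intros) auto

section \<open>The threshold\<close>

text \<open>For \<open>n = 100 * k\<close> the step counts \<open>T = 127 * k\<close> and
  \<open>K = 37 * k\<close> are integers with exactly the required ratios. The property is monotone,
  so an earlier time reaching \<open>q\<close> would force the probability at \<open>T\<close> to be
  at least \<open>q\<close>.\<close>

lemma tau_n_HAM_ge:
  assumes "1 \<le> k" "ham_bound (127 / 100) (9 / 10) (1 / real (100 * k)) < q"
  shows "enat (127 * k) \<le> tau_n HAM q (100 * k)"
  unfolding tau_n_def
proof (rule INF_greatest)
  fix S :: strategy
  let ?p = "\<lambda>t. measure_pmf.prob (history_pmf S (100 * k) t) {h. HAM (100 * k) (graph_of h)}"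
  have "127 * k \<le> t" if "q \<le> measure_pmf.prob (graph_pmf S (100 * k) t) {G. HAM (100 * k) G}" for t
  proof (rule ccontr)
    assume "\<not> 127 * k \<le> t"
    have "q \<le> ?p t"
      using that by (simp add: graph_pmf_def vimage_def)
    also have "?p t \<le> ?p (127 * k)"
    proof (rule prob_history_mono)
      fix h x assume "HAM (100 * k) (graph_of h)"
      then show "HAM (100 * k) (graph_of (h @ [x]))"
        using HAM_monotone_increasing unfolding monotone_increasing_def
        by (auto simp: graph_of_def elim!: allE impE)
    qed (use \<open>\<not> 127 * k \<le> t\<close> in simp)
    also have "\<dots> \<le> ham_bound (127 / 100) (9 / 10) (1 / real (100 * k))"
      using HAM_prob_le_ham_bound[of "100 * k" "37 * k" "127 * k" S] assms(1) by simp
    finally show False using assms(2) by simp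
  qed
  then show "enat (127 * k) \<le> tau_strategy HAM S q (100 * k)"
    unfolding tau_strategy_def by (intro Inf_greatest) auto
qed

text \<open>A limes superior is at least what is attained along a subsequence, so the multiples of
  100 suffice.\<close>

lemma tau_q_HAM_ge:
  assumes "ham_bound (127 / 100) (9 / 10) 0 < q"
  shows "ereal (127 / 100) \<le> tau_q HAM q"
proof (rule ccontr)
  assume "\<not> ?thesis"
  then have "\<forall>\<^sub>F n in sequentially. ereal_of_enat (tau_n HAM q n) / ereal (real n) < ereal (127 / 100)"
    unfolding tau_q_def by (intro Limsup_lessD) simp
  moreover have "filterlim (\<lambda>k::nat. 100 * k) sequentially sequentially"
    by real_asymp
  ultimately have "\<forall>\<^sub>F k in sequentially.
      ereal_of_enat (tau_n HAM q (100 * k)) / ereal (real (100 * k)) < ereal (127 / 100)"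
    by (rule eventually_compose_filterlim)
  moreover have "filterlim (\<lambda>k. 1 / real (100 * k)) (at 0) sequentially"
    by real_asymp
  then have "\<forall>\<^sub>F k in sequentially. ham_bound (127 / 100) (9 / 10) (1 / real (100 * k)) < q"
    using filterlim_compose[OF ham_bound_tendsto] order_tendstoD(2) assms by blast
  ultimately have "\<forall>\<^sub>F k :: nat in sequentially. False"
    using eventually_ge_at_top[of 1]
  proof eventually_elim
    case (elim k)
    have "ereal (127 / 100) = ereal_of_enat (enat (127 * k)) / ereal (real (100 * k))"
      using elim(3) by (simp add: field_simps)
    also have "\<dots> \<le> ereal_of_enat (tau_n HAM q (100 * k)) / ereal (real (100 * k))"
      using tau_n_HAM_ge[OF elim(3,2)] elim(3)
      by (intro ereal_divide_right_mono) (simp_all only: ereal_of_enat_le_iff, simp)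
    finally show ?case using elim(1) by simp
  qed
  then show False by simp
qed

text \<open>The limiting bound is below 1, so every \<open>q\<close> close enough to 1 exceeds it
  and the lower bound passes to the limit.\<close>

lemma tau_HAM_ge: "ereal (127 / 100) \<le> tau HAM"
proof (rule tendsto_lowerbound[OF tau_q_tendsto_tau])
  have "\<forall>\<^sub>F q in at_left 1. q \<in> {ham_bound (127 / 100) (9 / 10) 0<..<1}"
    using ham_bound_0_less by (auto simp: eventually_at_left_field)
  then show "\<forall>\<^sub>F q in at_left 1. ereal (127 / 100) \<le> tau_q HAM q"
    by eventually_elim (auto intro: tau_q_HAM_ge)
qed (simp add: trivial_limit_at_left_real)

theorem theorem1p2:
  shows "(\<exists>!s. 0 < s \<and> ham_f s - 1 = 0) \<and> \<bar>beta - 1.26575\<bar> < 1 / 10 ^ 5 \<and> tau HAM \<ge> ereal beta"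
proof (intro conjI ham_root_ex1 beta_close)
  have "beta \<le> 127 / 100"
    using beta_close by (auto simp: abs_if split: if_splits)
  then show "ereal beta \<le> tau HAM"
    using tau_HAM_ge by (metis ereal_less_eq(3) order.trans)
qed

end
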